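(* Let $\mathcal{V}=\mathcal{C}_{N,k}$ be the approximation space and $\mathcal{W}=\mathcal{D}_{N,2k-2}$ the double-grid space, with $V=\dim\mathcal{V}$ and $W=\dim\mathcal{W}$. Let $M:\Omega\to\mathbb{R}^{d\times d}$ be an integrable, uniformly positive definite and bounded matrix function, and let $\mathsf{A}\in\mathbb{R}^{V\times V}$ be the system matrix of the scalar elliptic problem, $$\mathsf{A}_{ij}=\int_\Omega M(x)\nabla\phi_{\mathcal{V}}^j(x)\cdot\nabla\phi_{\mathcal{V}}^i(x)\,dx.$$ Define $\mathsf{A}^{\mathrm{DoGIP}}\in\mathbb{R}^{d\times d\times W\times W}$ and $\mathsf{B}\in\mathbb{R}^{d\times W\times V}$ by $$\mathsf{A}^{\mathrm{DoGIP}}_{rsij}=\delta_{ij}\int_\Omega M_{rs}(x)\,\phi_{\mathcal{W}}^j(x)\,dx\quad\text{for }r,s\in\{1,\dots,d\},\ i,j\in\{1,\dots,W\},$$ $$\mathsf{B}_{rik}=\frac{\partial\phi_{\mathcal{V}}^k(x_{\mathcal{W}}^i)}{\partial x_r}\quad\text{for }r\in\{1,\dots,d\},\ i\in\{1,\dots,W\},\ k\in\{1,\dots,V\}.$$ Then for all $\mathsf{u},\mathsf{v}\in\mathbb{R}^V$, $$\mathsf{A}\mathsf{u}\cdot\mathsf{v}=\mathsf{B}^*\mathsf{A}^{\mathrm{DoGIP}}\mathsf{B}\,\mathsf{u}\cdot\mathsf{v}=\sum_{k,l=1}^V\sum_{r,s=1}^d\sum_{i,j=1}^W\mathsf{A}^{\mathrm{DoGIP}}_{rsij}\,\mathsf{B}_{sjl}\,\mathsf{u}_l\,\mathsf{B}_{rik}\,\mathsf{v}_k$$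 (the $k$ appearing as an index of $\mathsf{B}$ and $\mathsf{v}$ is a running index, not the polynomial order).
   Context: $\Omega\subset\mathbb{R}^d$ ($d=2$ or $3$) is a bounded open set with a finite mesh $\mathcal{M}=\mathcal{M}(\Omega)$ of non-overlapping simplexes $T$ (triangles or tetrahedra) covering $\Omega$, with no hanging nodes (a conforming simplicial mesh). The subscript $N$ is the discretisation parameter of the mesh. $\mathcal{P}_k$ is the space of real polynomials on $\mathbb{R}^d$ of total degree at most $k$, and $k\ge1$ is an integer. Define $$\mathcal{C}_{N,\ell}=\{v:\Omega\to\mathbb{R}\mid v|_T\in\mathcal{P}_\ell\ \forall T\in\mathcal{M},\ v\text{ continuous}\},\qquad \mathcal{D}_{N,\ell}=\{v:\Omega\to\mathbb{R}\mid v|_T\in\mathcal{P}_\ell\ \forall T\in\mathcal{M}\},$$ where functions in $\mathcal{D}_{N,\ell}$ may jump across element boundaries: restrictions are to element interiors, and values on facets are disregarded. Each such space $\mathcal{X}$ is equipped with its standard Lagrange finite element basis $\phi_{\mathcal{X}}^i$ and nodal points $x_{\mathcal{X}}^i$, $i=1,\dots,\dim\mathcal{X}$, with $\phi_{\mathcal{X}}^j(x_{\mathcal{X}}^i)=\delta_{ij}$, so that $v=\sum_i v(x_{\mathcal{X}}^i)\phi_{\mathcal{X}}^i$ for all $v\in\mathcal{X}$. For $\mathcal{D}_{N,\ell}$ each basis function $\phi^i$ is supported on a single element $T_i$ (and zero elsewhere), its node lies in the closure of $T_i$, and the value at the $i$-th node of any element-wise polynomial function $v$ (in particular of a derivative of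 a function in $\mathcal{C}_{N,k}$) is the continuous extension from $T_i$: $v(x^i)=\lim_{x\to x^i,\,x\in T_i}v(x)$. Thus nodes of different elements that coincide geometrically are treated as distinct nodes. Gradients and derivatives are taken element-wise. Uniform positive definiteness and boundedness of $M$ means that there are constants $c,C\in\mathbb{R}$ with $0<c\le \frac{M(x)y\cdot y}{\|y\|^2}\le C$ for all $x\in\Omega$ and all nonzero $y\in\mathbb{R}^d$. Array products are understood as $(\mathsf{B}\mathsf{u})_{sj}=\sum_l\mathsf{B}_{sjl}\mathsf{u}_l$ and $(\mathsf{A}^{\mathrm{DoGIP}}\mathsf{w})_{ri}=\sum_{s=1}^d\sum_{j=1}^W\mathsf{A}^{\mathrm{DoGIP}}_{rsij}\mathsf{w}_{sj}$. $\mathsf{B}^*:\mathbb{R}^{d\times W}\to\mathbb{R}^V$ is the adjoint of $\mathsf{B}$ with respect to the Euclidean inner products. *)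

theory Defs
  imports "HOL-Analysis.Analysis"
begin

definition poly_upto :: "nat \<Rightarrow> (real^'d \<Rightarrow> real) set" where
  "poly_upto k = {p. \<exists>a :: ('d \<Rightarrow> nat) \<Rightarrow> real.
     p = (\<lambda>x. \<Sum>\<alpha> | (\<Sum>i\<in>UNIV. \<alpha> i) \<le> k. a \<alpha> * (\<Prod>i\<in>UNIV. (x $ i) ^ \<alpha> i))}"

(* Elements are closed simplices of full dimension. The library notion triangulation makes any two
   of them meet in a common (possibly empty) face: no overlaps and no hanging nodes. *)
definition conforming_mesh :: "(real^'d) set \<Rightarrow> (real^'d) set set \<Rightarrow> bool" where
  "conforming_mesh \<Omega> \<M> \<longleftrightarrow>
     triangulation \<M> \<and> (\<forall>T\<in>\<M>. int CARD('d) simplex T \<and> interior T \<subseteq> \<Omega>) \<and> \<Omega> \<subseteq> \<Union>\<M>"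

(* Only values on element interiors matter: two members are the same finite element function
   iff they agree on the interior of every element. *)
definition discontinuous_space :: "(real^'d) set set \<Rightarrow> nat \<Rightarrow> (real^'d \<Rightarrow> real) set" where
  "discontinuous_space \<M> l = {v. \<forall>T\<in>\<M>. \<exists>p\<in>poly_upto l. \<forall>x\<in>interior T. v x = p x}"

definition continuous_space ::
  "(real^'d) set \<Rightarrow> (real^'d) set set \<Rightarrow> nat \<Rightarrow> (real^'d \<Rightarrow> real) set" where
  "continuous_space \<Omega> \<M> l =
     {v. continuous_on \<Omega> v \<and> (\<forall>T\<in>\<M>. \<exists>p\<in>poly_upto l. \<forall>x\<in>interior T. v x = p x)}"

definition value_from :: "(real^'d) set \<Rightarrow> real^'d \<Rightarrow> (real^'d \<Rightarrow> real) \<Rightarrow> real" where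
  "value_from T x v = Lim (at x within interior T) v"

(* The i-th node is the point x i together with an element T i containing it, from which values at
   the node are taken. So discontinuous spaces may have several nodes at one point; for a function
   that is continuous at x i the choice of T i is immaterial. The duality condition makes the
   \<phi> i linearly independent, so the index type 'n has as many elements as X has dimensions. *)
definition lagrange_basis ::
  "(real^'d) set set \<Rightarrow> (real^'d \<Rightarrow> real) set \<Rightarrow>
   ('n::finite \<Rightarrow> (real^'d) set) \<Rightarrow> ('n \<Rightarrow> real^'d) \<Rightarrow> ('n \<Rightarrow> real^'d \<Rightarrow> real) \<Rightarrow> bool" where
  "lagrange_basis \<M> X T x \<phi> \<longleftrightarrow>
     (\<forall>i. T i \<in> \<M> \<and> x i \<in> T i \<and> \<phi> i \<in> X) \<and>
     (\<forall>i j. value_from (T i) (x i) (\<phi> j) = (if i = j then 1 else 0)) \<and>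
     (\<forall>v\<in>X. \<forall>S\<in>\<M>. \<forall>y\<in>interior S. v y = (\<Sum>i\<in>UNIV. value_from (T i) (x i) v * \<phi> i y))"

(* For element-wise polynomials these are meaningful on element interiors; the remaining points
   of the domain form a null set. *)
definition partial_deriv :: "'d \<Rightarrow> (real^'d \<Rightarrow> real) \<Rightarrow> real^'d \<Rightarrow> real" where
  "partial_deriv r v x = frechet_derivative v (at x) (axis r 1)"

definition grad :: "(real^'d \<Rightarrow> real) \<Rightarrow> real^'d \<Rightarrow> real^'d" where
  "grad v x = (\<chi> r. partial_deriv r v x)"

definition uniformly_elliptic_bounded :: "(real^'d) set \<Rightarrow> (real^'d \<Rightarrow> real^'d^'d) \<Rightarrow> bool" where
  "uniformly_elliptic_bounded \<Omega> M \<longleftrightarrow>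
     (\<exists>c C. 0 < c \<and> (\<forall>x\<in>\<Omega>. \<forall>y. y \<noteq> 0 \<longrightarrow>
        c \<le> ((M x *v y) \<bullet> y) / (norm y)\<^sup>2 \<and> ((M x *v y) \<bullet> y) / (norm y)\<^sup>2 \<le> C))"

(* Integrals are with respect to the completed measure lebesgue: the integrands are arbitrary on
   facets, hence in general not Borel measurable. *)
definition system_matrix ::
  "(real^'d) set \<Rightarrow> (real^'d \<Rightarrow> real^'d^'d) \<Rightarrow> ('v \<Rightarrow> real^'d \<Rightarrow> real) \<Rightarrow> real^'v^'v" where
  "system_matrix \<Omega> M \<phi> =
     (\<chi> i j. LINT x:\<Omega>|lebesgue. (M x *v grad (\<phi> j) x) \<bullet> grad (\<phi> i) x)"

definition dogip_matrix ::
  "(real^'d) set \<Rightarrow> (real^'d \<Rightarrow> real^'d^'d) \<Rightarrow> ('w \<Rightarrow> real^'d \<Rightarrow> real) \<Rightarrow> real^'w^'w^'d^'d" where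
  "dogip_matrix \<Omega> M \<phi> =
     (\<chi> r s i j. (if i = j then 1 else 0) * (LINT x:\<Omega>|lebesgue. M x $ r $ s * \<phi> j x))"

definition interp_matrix ::
  "('v \<Rightarrow> real^'d \<Rightarrow> real) \<Rightarrow> ('w \<Rightarrow> (real^'d) set) \<Rightarrow> ('w \<Rightarrow> real^'d) \<Rightarrow> real^'v^'w^'d" where
  "interp_matrix \<phi> T x = (\<chi> r i k. value_from (T i) (x i) (partial_deriv r (\<phi> k)))"

definition array3_apply :: "real^'v^'w^'d \<Rightarrow> real^'v \<Rightarrow> real^'w^'d" where
  "array3_apply B u = (\<chi> s j. \<Sum>l\<in>UNIV. B $ s $ j $ l * u $ l)"

definition array4_apply :: "real^'w^'w^'d^'d \<Rightarrow> real^'w^'d \<Rightarrow> real^'w^'d" where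
  "array4_apply A w = (\<chi> r i. \<Sum>s\<in>UNIV. \<Sum>j\<in>UNIV. A $ r $ s $ i $ j * w $ s $ j)"

end

theory Submission
  imports Defs
begin

text \<open>
  The gradients of functions in the approximation space are element-wise polynomials of degree
  \<open>k - 1\<close>, so a product \<open>\<partial>\<^sub>s \<phi>\<^sub>j \<partial>\<^sub>r \<phi>\<^sub>i\<close> of two partial derivatives of basis functions lies in the
  discontinuous space of order \<open>2 k - 2\<close> (\<open>deriv_product_in_discontinuous_space\<close>). The double-grid
  space therefore reproduces it exactly from its nodal values. One-sided limits at a node are
  multiplicative, so each nodal value is a product of two entries of the interpolation array:
  with \<open>\<psi>\<^sub>m\<close> the basis of the double-grid space,
  \<open>\<partial>\<^sub>s \<phi>\<^sub>j \<partial>\<^sub>r \<phi>\<^sub>i = (\<Sum>m. B\<^sub>s\<^sub>m\<^sub>j B\<^sub>r\<^sub>m\<^sub>i \<psi>\<^sub>m)\<close> on the interior of every element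
  (\<open>deriv_product_interpolation\<close>). The coefficient \<open>M\<close> is left alone by this interpolation.
  Multiplying by \<open>M\<^sub>r\<^sub>s\<close>, summing over \<open>r\<close> and \<open>s\<close> and integrating turns the entry \<open>A\<^sub>i\<^sub>j\<close> into a
  contraction of two copies of \<open>B\<close> with the weights \<open>\<integral> M\<^sub>r\<^sub>s \<psi>\<^sub>m\<close>, which are the diagonal entries of
  the DoGIP matrix (\<open>system_matrix_entry\<close>). What remains is to move the adjoint to the other side
  of the inner product and to reorder finite sums.

  The basis functions are arbitrary on the facets. Facets lie in frontiers of convex sets and so
  form a null set (\<open>negligible_mesh_skeleton\<close>); integrals over the domain only see element
  interiors, where basis functions and their derivatives are polynomials, hence bounded and
  measurable. This makes the products with the integrable coefficient integrable
  (\<open>absolutely_integrable_mult_discontinuous\<close>), which is needed to integrate the sum term by term.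
\<close>

section \<open>Polynomials of bounded total degree\<close>

definition monomial :: "('d::finite \<Rightarrow> nat) \<Rightarrow> real^'d \<Rightarrow> real" where
  "monomial \<alpha> x = (\<Prod>i\<in>UNIV. (x $ i) ^ \<alpha> i)"

lemma finite_multiindices: "finite {\<alpha> :: 'd::finite \<Rightarrow> nat. (\<Sum>i\<in>UNIV. \<alpha> i) \<le> k}"
proof (rule finite_subset)
  show "{\<alpha> :: 'd \<Rightarrow> nat. (\<Sum>i\<in>UNIV. \<alpha> i) \<le> k} \<subseteq> Pi\<^sub>E UNIV (\<lambda>_. {..k})"
  proof (clarsimp simp: PiE_def Pi_def)
    fix \<alpha> :: "'d \<Rightarrow> nat" and i
    assume "sum \<alpha> UNIV \<le> k"
    moreover have "\<alpha> i \<le> sum \<alpha> UNIV" by (rule member_le_sum) auto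
    ultimately show "\<alpha> i \<le> k" by simp
  qed
qed (simp add: finite_PiE)

lemma poly_upto_iff:
  "p \<in> poly_upto k \<longleftrightarrow>
    (\<exists>a. p = (\<lambda>x. \<Sum>\<alpha> | (\<Sum>i\<in>UNIV. \<alpha> i) \<le> k. a \<alpha> * monomial \<alpha> x))"
  by (simp add: poly_upto_def monomial_def)

lemma poly_upto_E:
  assumes "p \<in> poly_upto k"
  obtains a where "p = (\<lambda>x. \<Sum>\<alpha> | (\<Sum>i\<in>UNIV. \<alpha> i) \<le> k. a \<alpha> * monomial \<alpha> x)"
  using assms poly_upto_iff by blast

lemma poly_upto_scaled_monomial:
  assumes "(\<Sum>i\<in>UNIV. \<alpha> i) \<le> k"
  shows "(\<lambda>x. c * monomial \<alpha> x) \<in> poly_upto k"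
proof -
  have "c * monomial \<alpha> x =
      (\<Sum>\<beta> | (\<Sum>i\<in>UNIV. \<beta> i) \<le> k. (if \<beta> = \<alpha> then c else 0) * monomial \<beta> x)" for x
    using assms by (simp add: if_distrib[of "\<lambda>c. c * _"] finite_multiindices cong: if_cong)
  then show ?thesis unfolding poly_upto_iff by (intro exI[of _ "\<lambda>\<beta>. if \<beta> = \<alpha> then c else 0"]) auto
qed

lemma poly_upto_zero: "(\<lambda>x. 0) \<in> poly_upto k"
  unfolding poly_upto_iff by (intro exI[of _ "\<lambda>_. 0"]) simp

lemma poly_upto_add:
  assumes "p \<in> poly_upto k" "q \<in> poly_upto k"
  shows "(\<lambda>x. p x + q x) \<in> poly_upto k"
proof -
  obtain a where a: "p = (\<lambda>x. \<Sum>\<alpha> | (\<Sum>i\<in>UNIV. \<alpha> i) \<le> k. a \<alpha> * monomial \<alpha> x)"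
    using assms(1) by (rule poly_upto_E)
  obtain b where b: "q = (\<lambda>x. \<Sum>\<alpha> | (\<Sum>i\<in>UNIV. \<alpha> i) \<le> k. b \<alpha> * monomial \<alpha> x)"
    using assms(2) by (rule poly_upto_E)
  show ?thesis
    unfolding poly_upto_iff a b
    by (intro exI[of _ "\<lambda>\<alpha>. a \<alpha> + b \<alpha>"]) (simp add: distrib_right sum.distrib)
qed

lemma poly_upto_sum:
  assumes "\<And>i. i \<in> I \<Longrightarrow> p i \<in> poly_upto k"
  shows "(\<lambda>x. \<Sum>i\<in>I. p i x) \<in> poly_upto k"
  using assms
  by (induction I rule: infinite_finite_induct) (auto intro: poly_upto_zero poly_upto_add)

lemma monomial_mult: "monomial \<alpha> x * monomial \<beta> x = monomial (\<lambda>i. \<alpha> i + \<beta> i) x"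
  by (simp add: monomial_def power_add prod.distrib)

lemma poly_upto_mult:
  assumes "p \<in> poly_upto m" "q \<in> poly_upto n"
  shows "(\<lambda>x. p x * q x) \<in> poly_upto (m + n)"
proof -
  obtain a where a: "p = (\<lambda>x. \<Sum>\<alpha> | (\<Sum>i\<in>UNIV. \<alpha> i) \<le> m. a \<alpha> * monomial \<alpha> x)"
    using assms(1) by (rule poly_upto_E)
  obtain b where b: "q = (\<lambda>x. \<Sum>\<alpha> | (\<Sum>i\<in>UNIV. \<alpha> i) \<le> n. b \<alpha> * monomial \<alpha> x)"
    using assms(2) by (rule poly_upto_E)
  have "(\<lambda>x. p x * q x) = (\<lambda>x. \<Sum>\<alpha> | (\<Sum>i\<in>UNIV. \<alpha> i) \<le> m. \<Sum>\<beta> | (\<Sum>i\<in>UNIV. \<beta> i) \<le> n.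
      a \<alpha> * b \<beta> * monomial (\<lambda>i. \<alpha> i + \<beta> i) x)"
    by (simp add: a b sum_product monomial_mult[symmetric] mult_ac)
  also have "\<dots> \<in> poly_upto (m + n)"
    by (intro poly_upto_sum poly_upto_scaled_monomial) (auto simp: sum.distrib)
  finally show ?thesis .
qed

text \<open>
  In direction \<open>r\<close> only the factor of coordinate \<open>r\<close> contributes to the product rule. For
  \<open>\<alpha> r = 0\<close> the truncated exponent \<open>\<alpha> r - 1\<close> is harmless, as its coefficient vanishes.
\<close>
lemma monomial_has_partial_derivative:
  obtains D where "(monomial \<alpha> has_derivative D) (at x)"
    "\<And>r. D (axis r 1) = real (\<alpha> r) * monomial (\<alpha>(r := \<alpha> r - 1)) x"
proof
  let ?D = "\<lambda>h. \<Sum>i\<in>UNIV. (real (\<alpha> i) * (h $ i) * (x $ i) ^ (\<alpha> i - 1)) *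
      (\<Prod>j\<in>UNIV - {i}. (x $ j) ^ \<alpha> j)"
  show "(monomial \<alpha> has_derivative ?D) (at x)"
    unfolding monomial_def
    by (rule has_derivative_prod)
      (auto intro!: derivative_eq_intros bounded_linear_imp_has_derivative bounded_linear_vec_nth)
  show "?D (axis r 1) = real (\<alpha> r) * monomial (\<alpha>(r := \<alpha> r - 1)) x" for r
  proof -
    have "?D (axis r 1) = (\<Sum>i\<in>UNIV. if i = r then real (\<alpha> r) * ((x $ r) ^ (\<alpha> r - 1) *
        (\<Prod>j\<in>UNIV - {r}. (x $ j) ^ \<alpha> j)) else 0)"
      by (intro sum.cong) (auto simp: axis_def)
    also have "\<dots> = real (\<alpha> r) * ((x $ r) ^ (\<alpha> r - 1) * (\<Prod>j\<in>UNIV - {r}. (x $ j) ^ \<alpha> j))"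
      by simp
    also have "(x $ r) ^ (\<alpha> r - 1) * (\<Prod>j\<in>UNIV - {r}. (x $ j) ^ \<alpha> j) =
        monomial (\<alpha>(r := \<alpha> r - 1)) x"
      unfolding monomial_def by (subst prod.remove[of UNIV r]) (auto intro!: prod.cong)
    finally show ?thesis .
  qed
qed

lemma poly_upto_has_derivative:
  fixes p :: "real^'d \<Rightarrow> real"
  assumes "p \<in> poly_upto k"
  shows "\<exists>q. (\<forall>r. q r \<in> poly_upto (k - 1)) \<and>
    (\<forall>x. \<exists>D. (p has_derivative D) (at x) \<and> (\<forall>r. D (axis r 1) = q r x))"
proof -
  obtain a where a: "p = (\<lambda>x. \<Sum>\<alpha> | (\<Sum>i\<in>UNIV. \<alpha> i) \<le> k. a \<alpha> * monomial \<alpha> x)"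
    using assms by (rule poly_upto_E)
  define q where "q r x = (\<Sum>\<alpha> | (\<Sum>i\<in>UNIV. \<alpha> i) \<le> k.
      (a \<alpha> * real (\<alpha> r)) * monomial (\<alpha>(r := \<alpha> r - 1)) x)" for r x
  show ?thesis
  proof (intro exI[of _ q] conjI allI)
    fix r
    have "(\<lambda>x. (a \<alpha> * real (\<alpha> r)) * monomial (\<alpha>(r := \<alpha> r - 1)) x) \<in> poly_upto (k - 1)"
      if deg: "(\<Sum>i\<in>UNIV. \<alpha> i) \<le> k" for \<alpha>
    proof (cases "\<alpha> r = 0")
      case True
      then show ?thesis using poly_upto_zero by simp
    next
      case False
      have "(\<Sum>i\<in>UNIV. \<alpha> i) = \<alpha> r + (\<Sum>i\<in>UNIV - {r}. \<alpha> i)"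
        by (rule sum.remove) auto
      moreover have "(\<Sum>i\<in>UNIV. (\<alpha>(r := \<alpha> r - 1)) i) = \<alpha> r - 1 + (\<Sum>i\<in>UNIV - {r}. \<alpha> i)"
        by (subst sum.remove[of UNIV r]) (auto intro!: sum.cong)
      ultimately have "(\<Sum>i\<in>UNIV. (\<alpha>(r := \<alpha> r - 1)) i) \<le> k - 1"
        using False deg by linarith
      then show ?thesis by (rule poly_upto_scaled_monomial)
    qed
    then show "q r \<in> poly_upto (k - 1)"
      unfolding q_def by (intro poly_upto_sum) simp
  next
    fix x
    have "\<exists>D. (monomial \<alpha> has_derivative D) (at x) \<and>
        (\<forall>r. D (axis r 1) = real (\<alpha> r) * monomial (\<alpha>(r := \<alpha> r - 1)) x)" for \<alpha> :: "'d \<Rightarrow> nat"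
      by (metis monomial_has_partial_derivative)
    then obtain D where D: "\<And>\<alpha>. (monomial \<alpha> has_derivative D \<alpha>) (at x)"
      "\<And>\<alpha> r. D \<alpha> (axis r 1) = real (\<alpha> r) * monomial (\<alpha>(r := \<alpha> r - 1)) x"
      by metis
    have "(p has_derivative (\<lambda>h. \<Sum>\<alpha> | (\<Sum>i\<in>UNIV. \<alpha> i) \<le> k. a \<alpha> * D \<alpha> h)) (at x)"
      unfolding a by (intro has_derivative_sum has_derivative_mult_right D)
    then show "\<exists>D. (p has_derivative D) (at x) \<and> (\<forall>r. D (axis r 1) = q r x)"
      by (intro exI conjI) (auto simp: D(2) q_def mult.assoc)
  qed
qed

lemma poly_upto_continuous_on:
  assumes "p \<in> poly_upto k"
  shows "continuous_on S p"
proof (rule continuous_at_imp_continuous_on, rule ballI)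
  fix x
  obtain D where "(p has_derivative D) (at x)"
    using poly_upto_has_derivative[OF assms] by blast
  then show "isCont p x" by (rule has_derivative_continuous)
qed

section \<open>Element-wise polynomials\<close>

lemma mesh_element:
  assumes "conforming_mesh \<Omega> \<M>" "T \<in> \<M>"
  shows "convex T" "closed T" "bounded T" "closure (interior T) = T" "interior T \<subseteq> \<Omega>"
proof -
  have T: "int CARD('a) simplex T" and "interior T \<subseteq> \<Omega>"
    using assms by (auto simp: conforming_mesh_def)
  then show "convex T" "closed T" "bounded T" "interior T \<subseteq> \<Omega>"
    by (auto simp: convex_simplex closed_simplex compact_imp_bounded compact_simplex)
  have dim: "aff_dim T = int CARD('a)" using T by (rule aff_dim_simplex)
  then have "T \<noteq> {}" by auto
  have "affine hull T = UNIV" using dim aff_dim_lt_full[of T] by auto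
  then have "interior T = rel_interior T" by (simp add: rel_interior_interior)
  then have "interior T \<noteq> {}"
    using \<open>convex T\<close> \<open>T \<noteq> {}\<close> by (simp add: rel_interior_eq_empty)
  then show "closure (interior T) = T"
    using \<open>convex T\<close> \<open>closed T\<close> by (simp add: convex_closure_interior)
qed

lemma negligible_mesh_skeleton:
  assumes "conforming_mesh \<Omega> \<M>"
  shows "negligible (\<Omega> - (\<Union>T\<in>\<M>. interior T))"
proof (rule negligible_subset)
  have "finite \<M>" "\<Omega> \<subseteq> \<Union>\<M>"
    using assms by (auto simp: conforming_mesh_def triangulation_def)
  then show "\<Omega> - (\<Union>T\<in>\<M>. interior T) \<subseteq> (\<Union>T\<in>\<M>. frontier T)"
    unfolding frontier_def by (blast intro: subsetD[OF closure_subset])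
  show "negligible (\<Union>T\<in>\<M>. frontier T)"
    using \<open>finite \<M>\<close> mesh_element(1)[OF assms]
    by (intro negligible_Union) (auto intro: negligible_convex_frontier)
qed

text \<open>
  The value of an element-wise polynomial at a node is the value there of the polynomial of the
  element. The node is a limit point of the element interior, so that the limit is unique, because
  the element is the closure of its interior.
\<close>
lemma value_from_eq:
  assumes mesh: "conforming_mesh \<Omega> \<M>" and "T \<in> \<M>" "x \<in> T"
    and p: "p \<in> poly_upto k" and vp: "\<And>y. y \<in> interior T \<Longrightarrow> v y = p y"
  shows "value_from T x v = p x"
proof -
  have "x islimpt closure (interior T)"
    using assms mesh_element(4)[OF mesh] by (intro islimpt_closure_open[of "interior T"]) auto
  then have nontriv: "\<not> trivial_limit (at x within interior T)"
    by (simp add: trivial_limit_within limpt_of_closure)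
  have "continuous_on UNIV p" using p by (rule poly_upto_continuous_on)
  then have "(p \<longlongrightarrow> p x) (at x within interior T)"
    by (meson UNIV_I continuous_on_def tendsto_within_subset subset_UNIV)
  then have "(v \<longlongrightarrow> p x) (at x within interior T)"
    by (rule Lim_transform_eventually) (auto simp: eventually_at_filter vp)
  then show ?thesis
    unfolding value_from_def using nontriv by (intro tendsto_Lim)
qed

text \<open>
  On the open set \<open>interior T\<close>, equality of functions passes to their derivatives.
\<close>
lemma discontinuous_space_partial_deriv:
  assumes "v \<in> discontinuous_space \<M> k"
  shows "partial_deriv r v \<in> discontinuous_space \<M> (k - 1)"
  unfolding discontinuous_space_def mem_Collect_eq
proof
  fix T assume "T \<in> \<M>"
  then obtain p where p: "p \<in> poly_upto k" and vp: "\<And>x. x \<in> interior T \<Longrightarrow> v x = p x"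
    using assms by (auto simp: discontinuous_space_def)
  obtain q where q: "\<And>r. q r \<in> poly_upto (k - 1)"
    and D: "\<And>x. \<exists>D. (p has_derivative D) (at x) \<and> (\<forall>r. D (axis r 1) = q r x)"
    using poly_upto_has_derivative[OF p] by blast
  have "partial_deriv r v x = q r x" if "x \<in> interior T" for x
  proof -
    obtain D where "(p has_derivative D) (at x)" and Dq: "D (axis r 1) = q r x"
      using D by blast
    then have "(v has_derivative D) (at x)"
      using has_derivative_transform_within_open[of p D x UNIV "interior T" v] that vp by auto
    then have "frechet_derivative v (at x) = D" by (metis frechet_derivative_at)
    then show ?thesis by (simp add: partial_deriv_def Dq)
  qed
  then show "\<exists>q\<in>poly_upto (k - 1). \<forall>x\<in>interior T. partial_deriv r v x = q x"
    using q by blast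
qed

lemma discontinuous_space_mult:
  assumes "f \<in> discontinuous_space \<M> m" "g \<in> discontinuous_space \<M> n"
  shows "(\<lambda>x. f x * g x) \<in> discontinuous_space \<M> (m + n)"
  unfolding discontinuous_space_def mem_Collect_eq
proof
  fix T assume "T \<in> \<M>"
  then obtain p q where "p \<in> poly_upto m" "q \<in> poly_upto n"
    and "\<And>x. x \<in> interior T \<Longrightarrow> f x = p x" "\<And>x. x \<in> interior T \<Longrightarrow> g x = q x"
    using assms unfolding discontinuous_space_def by blast
  then show "\<exists>p\<in>poly_upto (m + n). \<forall>x\<in>interior T. f x * g x = p x"
    by (intro bexI[of _ "\<lambda>x. p x * q x"]) (auto intro: poly_upto_mult)
qed

lemma value_from_mult:
  assumes "conforming_mesh \<Omega> \<M>" "T \<in> \<M>" "x \<in> T"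
    and "f \<in> discontinuous_space \<M> m" "g \<in> discontinuous_space \<M> n"
  shows "value_from T x (\<lambda>x. f x * g x) = value_from T x f * value_from T x g"
proof -
  obtain p q where p: "p \<in> poly_upto m" and q: "q \<in> poly_upto n"
    and fp: "\<And>x. x \<in> interior T \<Longrightarrow> f x = p x" and gq: "\<And>x. x \<in> interior T \<Longrightarrow> g x = q x"
    using assms unfolding discontinuous_space_def by blast
  have "value_from T x (\<lambda>x. f x * g x) = p x * q x"
    using poly_upto_mult[OF p q] fp gq by (intro value_from_eq[OF assms(1-3)]) auto
  then show ?thesis
    using value_from_eq[OF assms(1-3) p fp] value_from_eq[OF assms(1-3) q gq] by simp
qed

text \<open>
  The double-grid order \<open>2 k - 2\<close> is that of a product of two first derivatives.
\<close>
lemma deriv_product_in_discontinuous_space: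
  assumes "f \<in> discontinuous_space \<M> k" "g \<in> discontinuous_space \<M> k"
  shows "(\<lambda>x. partial_deriv s f x * partial_deriv r g x) \<in> discontinuous_space \<M> (2 * k - 2)"
proof -
  have "2 * k - 2 = (k - 1) + (k - 1)" by simp
  then show ?thesis
    using assms by (metis discontinuous_space_mult discontinuous_space_partial_deriv)
qed

text \<open>
  The Lagrange expansion of a product of derivatives is exact because of its degree, and its nodal
  values factorise because one-sided limits do.
\<close>
lemma deriv_product_interpolation:
  assumes mesh: "conforming_mesh \<Omega> \<M>"
    and V: "\<And>i. \<phi> i \<in> discontinuous_space \<M> k"
    and W: "lagrange_basis \<M> (discontinuous_space \<M> (2 * k - 2)) T x \<psi>"
    and S: "S \<in> \<M>" "y \<in> interior S"
  shows "partial_deriv s (\<phi> j) y * partial_deriv r (\<phi> i) y =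
    (\<Sum>m\<in>UNIV. interp_matrix \<phi> T x $ s $ m $ j * interp_matrix \<phi> T x $ r $ m $ i * \<psi> m y)"
proof -
  have "partial_deriv s (\<phi> j) y * partial_deriv r (\<phi> i) y =
      (\<Sum>m\<in>UNIV. value_from (T m) (x m)
        (\<lambda>z. partial_deriv s (\<phi> j) z * partial_deriv r (\<phi> i) z) * \<psi> m y)"
    using W S deriv_product_in_discontinuous_space[OF V V]
    by (auto simp: lagrange_basis_def)
  also have "\<dots> = (\<Sum>m\<in>UNIV. interp_matrix \<phi> T x $ s $ m $ j *
      interp_matrix \<phi> T x $ r $ m $ i * \<psi> m y)"
  proof (rule sum.cong)
    fix m
    have "T m \<in> \<M>" "x m \<in> T m" using W by (auto simp: lagrange_basis_def)
    from value_from_mult[OF mesh this discontinuous_space_partial_deriv[OF V]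
        discontinuous_space_partial_deriv[OF V]]
    show "value_from (T m) (x m) (\<lambda>z. partial_deriv s (\<phi> j) z * partial_deriv r (\<phi> i) z) * \<psi> m y =
        interp_matrix \<phi> T x $ s $ m $ j * interp_matrix \<phi> T x $ r $ m $ i * \<psi> m y"
      by (simp add: interp_matrix_def)
  qed simp
  finally show ?thesis .
qed

section \<open>Integration over the mesh\<close>

text \<open>
  On each element \<open>f\<close> agrees with a polynomial, which is continuous and bounded there because
  elements are compact. The finitely many element interiors make up the domain up to a null set.
\<close>
lemma absolutely_integrable_mult_discontinuous:
  fixes g :: "real^'d \<Rightarrow> real"
  assumes mesh: "conforming_mesh \<Omega> \<M>"
    and g: "g absolutely_integrable_on \<Omega>" and f: "f \<in> discontinuous_space \<M> l"
  shows "(\<lambda>x. g x * f x) absolutely_integrable_on \<Omega>"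
proof -
  have "finite \<M>" using mesh by (simp add: conforming_mesh_def triangulation_def)
  have "(\<lambda>x. g x * f x) absolutely_integrable_on interior T" if T: "T \<in> \<M>" for T
  proof -
    note elem = mesh_element[OF mesh T]
    obtain p where p: "p \<in> poly_upto l" and fp: "\<And>x. x \<in> interior T \<Longrightarrow> f x = p x"
      using f T by (auto simp: discontinuous_space_def)
    have "compact (p ` T)"
      using elem p by (intro compact_continuous_image poly_upto_continuous_on)
        (auto simp: compact_eq_bounded_closed)
    then have "bounded (p ` interior T)"
      by (meson bounded_subset compact_imp_bounded image_mono interior_subset)
    moreover have "p \<in> borel_measurable (lebesgue_on (interior T))"
      by (intro continuous_imp_measurable_on_sets_lebesgue poly_upto_continuous_on[OF p]) auto
    moreover have "g absolutely_integrable_on interior T"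
      by (rule set_integrable_subset[OF g _ elem(5)]) auto
    ultimately have "(\<lambda>x. p x * g x) absolutely_integrable_on interior T"
      by (intro absolutely_integrable_bounded_measurable_product[OF bilinear_times]) auto
    then show ?thesis
      by (rule absolutely_integrable_spike[of _ _ "{}"]) (auto simp: fp)
  qed
  then have "(\<lambda>x. g x * f x) absolutely_integrable_on (\<Union>T\<in>\<M>. interior T)"
    using \<open>finite \<M>\<close> by (intro set_integrable_UN) auto
  moreover have "(\<Union>T\<in>\<M>. interior T) \<subseteq> \<Omega>"
    using mesh_element(5)[OF mesh] by blast
  then have "(\<Union>T\<in>\<M>. interior T) - \<Omega> = {}" by blast
  then have "negligible {x \<in> (\<Union>T\<in>\<M>. interior T) - \<Omega>. g x * f x \<noteq> 0}"
    by (metis (no_types, lifting) empty_iff Collect_empty_eq negligible_empty)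
  moreover have "negligible {x \<in> \<Omega> - (\<Union>T\<in>\<M>. interior T). g x * f x \<noteq> 0}"
    by (rule negligible_subset[OF negligible_mesh_skeleton[OF mesh]]) auto
  ultimately show ?thesis
    using absolutely_integrable_spike_set_eq[of "\<Union>T\<in>\<M>. interior T" \<Omega>
        "\<lambda>x. g x * f x"] by blast
qed

text \<open>
  Pulling the nodal values out of the integral leaves the diagonal blocks of the DoGIP matrix. The
  two integrands agree on element interiors only, which is enough for the integrals; absolute
  integrability carries over from the right-hand side in the same way.
\<close>
lemma system_matrix_entry:
  fixes M :: "real^'d \<Rightarrow> real^'d^'d"
  assumes mesh: "conforming_mesh \<Omega> \<M>"
    and V: "\<And>i. \<phi> i \<in> discontinuous_space \<M> k"
    and W: "lagrange_basis \<M> (discontinuous_space \<M> (2 * k - 2)) T x \<psi>"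
    and M: "set_integrable lebesgue \<Omega> M"
  defines "B \<equiv> interp_matrix \<phi> T x"
  shows "system_matrix \<Omega> M \<phi> $ i $ j = (\<Sum>r\<in>UNIV. \<Sum>s\<in>UNIV. \<Sum>m\<in>UNIV.
    dogip_matrix \<Omega> M \<psi> $ r $ s $ m $ m * B $ s $ m $ j * B $ r $ m $ i)"
proof -
  let ?F = "\<lambda>y. (M y *v grad (\<phi> j) y) \<bullet> grad (\<phi> i) y"
  let ?I = "\<lambda>r s m y. B $ s $ m $ j * B $ r $ m $ i * (M y $ r $ s * \<psi> m y)"
  have M_entry: "(\<lambda>y. M y $ r $ s) absolutely_integrable_on \<Omega>" for r s
  proof -
    have "bounded_linear (\<lambda>A::real^'d^'d. A $ r $ s)"
      by (intro bounded_linear_compose[OF bounded_linear_vec_nth] bounded_linear_vec_nth)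
    from absolutely_integrable_linear[OF M this] show ?thesis by (simp add: o_def)
  qed
  have "\<psi> m \<in> discontinuous_space \<M> (2 * k - 2)" for m
    using W by (simp add: lagrange_basis_def)
  then have int: "?I r s m absolutely_integrable_on \<Omega>" for r s m
    by (intro set_integrable_mult_right absolutely_integrable_mult_discontinuous[OF mesh M_entry])
  have F: "?F y = (\<Sum>r\<in>UNIV. \<Sum>s\<in>UNIV. \<Sum>m\<in>UNIV. ?I r s m y)"
    if y: "y \<in> \<Omega> - (\<Omega> - (\<Union>T\<in>\<M>. interior T))" for y
  proof -
    obtain S where S: "S \<in> \<M>" "y \<in> interior S" using y by blast
    have "?F y = (\<Sum>r\<in>UNIV. \<Sum>s\<in>UNIV.
        M y $ r $ s * (partial_deriv s (\<phi> j) y * partial_deriv r (\<phi> i) y))"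
      by (simp add: inner_vec_def matrix_vector_mult_def grad_def sum_distrib_right mult.assoc)
    also have "\<dots> = (\<Sum>r\<in>UNIV. \<Sum>s\<in>UNIV. \<Sum>m\<in>UNIV. ?I r s m y)"
      unfolding deriv_product_interpolation[where \<phi> = \<phi>, OF mesh V W S] B_def
      by (simp add: sum_distrib_left mult_ac)
    finally show ?thesis .
  qed
  have int_sum: "(\<lambda>y. \<Sum>r\<in>UNIV. \<Sum>s\<in>UNIV. \<Sum>m\<in>UNIV. ?I r s m y) absolutely_integrable_on \<Omega>"
    by (intro absolutely_integrable_sum int) auto
  then have int_F: "?F absolutely_integrable_on \<Omega>"
    by (rule absolutely_integrable_spike[OF _ negligible_mesh_skeleton[OF mesh] F])
  have "system_matrix \<Omega> M \<phi> $ i $ j = integral \<Omega> ?F"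
    unfolding system_matrix_def using set_lebesgue_integral_eq_integral(2)[OF int_F] by simp
  also have "\<dots> = integral \<Omega> (\<lambda>y. \<Sum>r\<in>UNIV. \<Sum>s\<in>UNIV. \<Sum>m\<in>UNIV. ?I r s m y)"
    by (rule integral_spike[OF negligible_mesh_skeleton[OF mesh] F[symmetric]])
  also have "\<dots> = (\<Sum>r\<in>UNIV. \<Sum>s\<in>UNIV. \<Sum>m\<in>UNIV. integral \<Omega> (?I r s m))"
    using int by (simp add: integral_sum integrable_sum set_lebesgue_integral_eq_integral(1))
  also have "\<dots> = (\<Sum>r\<in>UNIV. \<Sum>s\<in>UNIV. \<Sum>m\<in>UNIV.
      dogip_matrix \<Omega> M \<psi> $ r $ s $ m $ m * B $ s $ m $ j * B $ r $ m $ i)"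
  proof (intro sum.cong refl)
    fix r s m
    have "integral \<Omega> (?I r s m) = (LINT y:\<Omega>|lebesgue. ?I r s m y)"
      by (rule set_lebesgue_integral_eq_integral(2)[OF int, symmetric])
    also have "\<dots> = dogip_matrix \<Omega> M \<psi> $ r $ s $ m $ m * B $ s $ m $ j * B $ r $ m $ i"
      unfolding set_integral_mult_right by (simp add: dogip_matrix_def)
    finally show "integral \<Omega> (?I r s m) =
        dogip_matrix \<Omega> M \<psi> $ r $ s $ m $ m * B $ s $ m $ j * B $ r $ m $ i" .
  qed
  finally show ?thesis .
qed

section \<open>The factorised bilinear form\<close>

lemma linear_array3_apply: "linear (array3_apply B)"
  by (rule linearI)
    (simp_all add: array3_apply_def vec_eq_iff algebra_simps sum.distrib sum_distrib_left)

lemma sum_basis_indices_outermost: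
  "(\<Sum>r\<in>R. \<Sum>i\<in>I. \<Sum>k\<in>K. \<Sum>s\<in>S. \<Sum>j\<in>J. \<Sum>l\<in>L. t r i s j l k) =
    (\<Sum>k\<in>K. \<Sum>l\<in>L. \<Sum>r\<in>R. \<Sum>s\<in>S. \<Sum>i\<in>I. \<Sum>j\<in>J. t r i s j l k)"
  by (simp only: sum.swap[of _ K I] sum.swap[of _ K R] sum.swap[of _ L J] sum.swap[of _ L S]
      sum.swap[of _ L I] sum.swap[of _ L R] sum.swap[of _ S I])

lemma adjoint_array3_apply_inner:
  "adjoint (array3_apply B) (array4_apply A (array3_apply B u)) \<bullet> v =
    (\<Sum>k\<in>UNIV. \<Sum>l\<in>UNIV. \<Sum>r\<in>UNIV. \<Sum>s\<in>UNIV. \<Sum>i\<in>UNIV. \<Sum>j\<in>UNIV.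
       A $ r $ s $ i $ j * B $ s $ j $ l * u $ l * B $ r $ i $ k * v $ k)" (is "?L = ?R")
proof -
  let ?t = "\<lambda>r i s j l k. A $ r $ s $ i $ j * B $ s $ j $ l * u $ l * B $ r $ i $ k * v $ k"
  have "?L = array4_apply A (array3_apply B u) \<bullet> array3_apply B v"
    by (rule adjoint_clauses(2)[OF linear_array3_apply])
  also have "\<dots> = (\<Sum>r\<in>UNIV. \<Sum>i\<in>UNIV. \<Sum>k\<in>UNIV. \<Sum>s\<in>UNIV. \<Sum>j\<in>UNIV. \<Sum>l\<in>UNIV. ?t r i s j l k)"
    by (simp add: inner_vec_def array3_apply_def array4_apply_def sum_distrib_left
        sum_distrib_right mult.assoc)
  also have "\<dots> = ?R" by (rule sum_basis_indices_outermost)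
  finally show ?thesis .
qed

theorem theorem8:
  fixes \<Omega> :: "(real^'d) set" and \<M> :: "(real^'d) set set" and k :: nat
    and M :: "real^'d \<Rightarrow> real^'d^'d"
    and elem\<^sub>V :: "'v::finite \<Rightarrow> (real^'d) set" and node\<^sub>V :: "'v \<Rightarrow> real^'d"
    and \<phi>\<^sub>V :: "'v \<Rightarrow> real^'d \<Rightarrow> real"
    and elem\<^sub>W :: "'w::finite \<Rightarrow> (real^'d) set" and node\<^sub>W :: "'w \<Rightarrow> real^'d"
    and \<phi>\<^sub>W :: "'w \<Rightarrow> real^'d \<Rightarrow> real"
    and A :: "real^'v^'v" and A\<^sub>D :: "real^'w^'w^'d^'d" and B :: "real^'v^'w^'d"
    and u v :: "real^'v"
  assumes "CARD('d) = 2 \<or> CARD('d) = 3"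
    and "bounded \<Omega>" and "open \<Omega>" and "conforming_mesh \<Omega> \<M>"
    and "k \<ge> 1"
    and "lagrange_basis \<M> (continuous_space \<Omega> \<M> k) elem\<^sub>V node\<^sub>V \<phi>\<^sub>V"
    and "lagrange_basis \<M> (discontinuous_space \<M> (2 * k - 2)) elem\<^sub>W node\<^sub>W \<phi>\<^sub>W"
    and "\<And>i T x. T \<in> \<M> \<Longrightarrow> T \<noteq> elem\<^sub>W i \<Longrightarrow> x \<in> interior T \<Longrightarrow> \<phi>\<^sub>W i x = 0"
    and "set_integrable lebesgue \<Omega> M"
    and "uniformly_elliptic_bounded \<Omega> M"
  defines "A \<equiv> system_matrix \<Omega> M \<phi>\<^sub>V"
    and "A\<^sub>D \<equiv> dogip_matrix \<Omega> M \<phi>\<^sub>W"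
    and "B \<equiv> interp_matrix \<phi>\<^sub>V elem\<^sub>W node\<^sub>W"
  shows "(A *v u) \<bullet> v = adjoint (array3_apply B) (array4_apply A\<^sub>D (array3_apply B u)) \<bullet> v \<and>
    adjoint (array3_apply B) (array4_apply A\<^sub>D (array3_apply B u)) \<bullet> v =
      (\<Sum>k\<in>UNIV. \<Sum>l\<in>UNIV. \<Sum>r\<in>UNIV. \<Sum>s\<in>UNIV. \<Sum>i\<in>UNIV. \<Sum>j\<in>UNIV.
         A\<^sub>D $ r $ s $ i $ j * B $ s $ j $ l * u $ l * B $ r $ i $ k * v $ k)"
proof
  have V: "\<phi>\<^sub>V i \<in> discontinuous_space \<M> k" for i
    using assms(6) by (simp add: lagrange_basis_def continuous_space_def discontinuous_space_def)
  show "adjoint (array3_apply B) (array4_apply A\<^sub>D (array3_apply B u)) \<bullet> v =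
      (\<Sum>k\<in>UNIV. \<Sum>l\<in>UNIV. \<Sum>r\<in>UNIV. \<Sum>s\<in>UNIV. \<Sum>i\<in>UNIV. \<Sum>j\<in>UNIV.
         A\<^sub>D $ r $ s $ i $ j * B $ s $ j $ l * u $ l * B $ r $ i $ k * v $ k)"
    by (rule adjoint_array3_apply_inner)
  \<comment> \<open>The DoGIP matrix is diagonal in its last two indices, so the sum over \<open>j\<close> collapses.\<close>
  have diag: "(\<Sum>j\<in>UNIV. A\<^sub>D $ r $ s $ i $ j * B $ s $ j $ l * u $ l * B $ r $ i $ k * v $ k) =
      A\<^sub>D $ r $ s $ i $ i * B $ s $ i $ l * B $ r $ i $ k * u $ l * v $ k" for r s i k l
  proof -
    have "(\<Sum>j\<in>UNIV. A\<^sub>D $ r $ s $ i $ j * B $ s $ j $ l * u $ l * B $ r $ i $ k * v $ k) =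
        (\<Sum>j\<in>UNIV. if j = i then A\<^sub>D $ r $ s $ i $ i * B $ s $ i $ l * B $ r $ i $ k * u $ l * v $ k
          else 0)"
      by (intro sum.cong) (auto simp: A\<^sub>D_def dogip_matrix_def)
    then show ?thesis by simp
  qed
  have "(A *v u) \<bullet> v = (\<Sum>k\<in>UNIV. \<Sum>l\<in>UNIV. A $ k $ l * u $ l * v $ k)"
    by (simp add: inner_vec_def matrix_vector_mult_def sum_distrib_right)
  also have "\<dots> = (\<Sum>k\<in>UNIV. \<Sum>l\<in>UNIV. \<Sum>r\<in>UNIV. \<Sum>s\<in>UNIV. \<Sum>i\<in>UNIV. \<Sum>j\<in>UNIV.
         A\<^sub>D $ r $ s $ i $ j * B $ s $ j $ l * u $ l * B $ r $ i $ k * v $ k)"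
    unfolding diag A_def system_matrix_entry[where \<phi> = \<phi>\<^sub>V, OF assms(4) V assms(7,9)]
    by (simp add: A\<^sub>D_def B_def sum_distrib_right)
  also have "\<dots> = adjoint (array3_apply B) (array4_apply A\<^sub>D (array3_apply B u)) \<bullet> v"
    by (rule adjoint_array3_apply_inner[symmetric])
  finally show "(A *v u) \<bullet> v = \<dots>" .
qed

end
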